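(* The number of leaves in a uniformly random rooted map with $n$ edges (no restriction on genus) converges in distribution, as $n\to\infty$, to the Poisson law with parameter $1$.
   Context: A map is a connected multigraph (loops and multiple edges allowed) endowed with a cyclic ordering of the half-edges incident to each vertex. The degree of a vertex is the number of half-edges incident to it; a leaf is a vertex of degree 1. Around each vertex, each pair of consecutive half-edges in the cyclic order forms a corner (a vertex with only one half-edge has one corner; a vertex of degree $d\ge1$ has $d$ corners; the one-vertex map with no edge has exactly one corner). A rooted map is a map with a distinguished corner. Rooted maps are considered up to isomorphisms preserving the graph structure, the root corner and the cyclic orderings. "Random rooted map with $n$ edges" means that all rooted maps with $n$ edges are equally likely. *)

theory Defs
  imports
    "HOL-Probability.Probability"
    "HOL-Combinatorics.Orbits"
    "Graph_Theory.Graph_Theory"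
begin

text \<open>
  A half-edge is an arc of a bidirected multigraph, its tail being the vertex that the half-edge
  is incident to. The fixed-point-free involution \<open>opp\<close> sends a half-edge to the other
  half of the same edge, so a loop has two half-edges, both incident to the same vertex.
  Restricted to the half-edges at one vertex, \<open>nxt\<close> is the cyclic ordering.
\<close>

record ('v, 'h) emb_graph =
  graph :: "('v, 'h) pre_digraph"
  opp :: "'h \<Rightarrow> 'h"
  nxt :: "'h \<Rightarrow> 'h"

abbreviation vertices :: "('v, 'h, 'x) emb_graph_scheme \<Rightarrow> 'v set" where
  "vertices M \<equiv> verts (graph M)"

abbreviation half_edges :: "('v, 'h, 'x) emb_graph_scheme \<Rightarrow> 'h set" where
  "half_edges M \<equiv> arcs (graph M)"

abbreviation half_edges_at :: "('v, 'h, 'x) emb_graph_scheme \<Rightarrow> 'v \<Rightarrow> 'h set" where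
  "half_edges_at M v \<equiv> out_arcs (graph M) v"

definition is_map :: "('v, 'h, 'x) emb_graph_scheme \<Rightarrow> bool" where
  "is_map M \<longleftrightarrow>
     fin_digraph (graph M) \<and> bidirected_digraph (graph M) (opp M) \<and>
     Digraph_Component.connected (graph M) \<and>
     (\<forall>v\<in>vertices M. half_edges_at M v \<noteq> {} \<longrightarrow> cyclic_on (nxt M) (half_edges_at M v))"

definition edges :: "('v, 'h, 'x) emb_graph_scheme \<Rightarrow> 'h set set" where
  "edges M = (\<lambda>h. {h, opp M h}) ` half_edges M"

definition vertex_degree :: "('v, 'h, 'x) emb_graph_scheme \<Rightarrow> 'v \<Rightarrow> nat" where
  "vertex_degree M v = card (half_edges_at M v)"

definition leaves :: "('v, 'h, 'x) emb_graph_scheme \<Rightarrow> 'v set" where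
  "leaves M = {v \<in> vertices M. vertex_degree M v = 1}"

text \<open>
  \<open>Between h h'\<close> is the corner delimited by the consecutive half-edges \<open>h\<close> and \<open>h'\<close>;
  \<open>Around v\<close> is the only corner of a vertex \<open>v\<close> without half-edges.
\<close>

datatype ('v, 'h) corner = Around 'v | Between 'h 'h

definition corners :: "('v, 'h, 'x) emb_graph_scheme \<Rightarrow> ('v, 'h) corner set" where
  "corners M =
     Around ` {v \<in> vertices M. half_edges_at M v = {}} \<union>
     (\<lambda>h. Between h (nxt M h)) ` half_edges M"

record ('v, 'h) rooted_emb_graph = "('v, 'h) emb_graph" +
  root :: "('v, 'h) corner"

definition is_rooted_map :: "('v, 'h) rooted_emb_graph \<Rightarrow> bool" where
  "is_rooted_map M \<longleftrightarrow> is_map M \<and> root M \<in> corners M"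

text \<open>
  Only the values of the components on vertices and half-edges of the map matter. Preservation of
  heads follows from preservation of tails and of \<open>opp\<close>.
\<close>

definition rooted_iso ::
    "('v, 'h) rooted_emb_graph \<Rightarrow> ('w, 'k) rooted_emb_graph \<Rightarrow> bool" where
  "rooted_iso M N \<longleftrightarrow>
     (\<exists>f g. bij_betw f (vertices M) (vertices N) \<and>
        bij_betw g (half_edges M) (half_edges N) \<and>
        (\<forall>h\<in>half_edges M.
           tail (graph N) (g h) = f (tail (graph M) h) \<and>
           opp N (g h) = g (opp M h) \<and>
           nxt N (g h) = g (nxt M h)) \<and>
        root N = map_corner f g (root M))"

text \<open>
  All maps are finite, so each of them has an isomorphic copy whose vertices and half-edges are
  natural numbers.
\<close>

type_synonym nat_map = "(nat, nat) rooted_emb_graph"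

definition map_representatives :: "nat \<Rightarrow> nat_map set" where
  "map_representatives n = {M. is_rooted_map M \<and> card (edges M) = n}"

definition rooted_maps :: "nat \<Rightarrow> nat_map set set" where
  "rooted_maps n =
     map_representatives n //
       {(M, N). M \<in> map_representatives n \<and> N \<in> map_representatives n \<and> rooted_iso M N}"

definition num_leaves :: "nat_map set \<Rightarrow> nat" where
  "num_leaves C = card (leaves (SOME M. M \<in> C))"

definition random_rooted_map :: "nat \<Rightarrow> nat_map set pmf" where
  "random_rooted_map n = pmf_of_set (rooted_maps n)"

text \<open>The remaining facts show that \<open>num_leaves\<close> does not depend on the chosen representative.\<close>

lemma nxt_in_half_edges:
  assumes "is_map M" "h \<in> half_edges M"
  shows "nxt M h \<in> half_edges M"
proof -
  interpret fin_digraph "graph M" using assms(1) by (simp add: is_map_def)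
  have "h \<in> half_edges_at M (tail (graph M) h)" using assms(2) by simp
  moreover from this have "cyclic_on (nxt M) (half_edges_at M (tail (graph M) h))"
    using assms unfolding is_map_def by (metis empty_iff tail_in_verts)
  ultimately have "nxt M h \<in> half_edges_at M (tail (graph M) h)"
    by (metis cyclic_on_inI)
  thus ?thesis by simp
qed

lemma opp_in_half_edges:
  assumes "is_map M" "h \<in> half_edges M"
  shows "opp M h \<in> half_edges M"
  using assms unfolding is_map_def by (blast intro: bidirected_digraph.arev_in_arcs)

lemma rooted_iso_refl: "rooted_iso M M"
  unfolding rooted_iso_def
  by (rule exI[of _ id], rule exI[of _ id]) (simp add: corner.map_id)

lemma rooted_iso_trans:
  assumes "rooted_iso M N" "rooted_iso N P"
  shows "rooted_iso M P"
proof -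
  obtain f g where 1:
    "bij_betw f (vertices M) (vertices N)" "bij_betw g (half_edges M) (half_edges N)"
    "\<forall>h\<in>half_edges M. tail (graph N) (g h) = f (tail (graph M) h) \<and>
       opp N (g h) = g (opp M h) \<and> nxt N (g h) = g (nxt M h)"
    "root N = map_corner f g (root M)"
    using assms(1) unfolding rooted_iso_def by blast
  obtain f' g' where 2:
    "bij_betw f' (vertices N) (vertices P)" "bij_betw g' (half_edges N) (half_edges P)"
    "\<forall>h\<in>half_edges N. tail (graph P) (g' h) = f' (tail (graph N) h) \<and>
       opp P (g' h) = g' (opp N h) \<and> nxt P (g' h) = g' (nxt N h)"
    "root P = map_corner f' g' (root N)"
    using assms(2) unfolding rooted_iso_def by blast
  have "g h \<in> half_edges N" if "h \<in> half_edges M" for h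
    using 1(2) that by (rule bij_betwE[THEN bspec])
  then show ?thesis
    unfolding rooted_iso_def
    using bij_betw_trans[OF 1(1) 2(1)] bij_betw_trans[OF 1(2) 2(2)] 1(3,4) 2(3,4)
    by (intro exI[of _ "f' \<circ> f"] exI[of _ "g' \<circ> g"]) (simp add: corner.map_comp)
qed

lemma rooted_iso_sym:
  assumes "is_rooted_map M" "rooted_iso M N"
  shows "rooted_iso N M"
proof -
  have M: "is_map M" "root M \<in> corners M" using assms(1) by (auto simp: is_rooted_map_def)
  interpret fin_digraph "graph M" using M by (simp add: is_map_def)
  obtain f g where fg:
    "bij_betw f (vertices M) (vertices N)" "bij_betw g (half_edges M) (half_edges N)"
    "\<forall>h\<in>half_edges M. tail (graph N) (g h) = f (tail (graph M) h) \<and>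
       opp N (g h) = g (opp M h) \<and> nxt N (g h) = g (nxt M h)"
    "root N = map_corner f g (root M)"
    using assms(2) unfolding rooted_iso_def by blast
  let ?f = "inv_into (vertices M) f" and ?g = "inv_into (half_edges M) g"
  have f: "?f (f v) = v" if "v \<in> vertices M" for v
    using fg(1) that by (rule bij_betw_inv_into_left)
  have g: "?g (g h) = h" if "h \<in> half_edges M" for h
    using fg(2) that by (rule bij_betw_inv_into_left)
  have "tail (graph M) (?g k) = ?f (tail (graph N) k) \<and>
      opp M (?g k) = ?g (opp N k) \<and> nxt M (?g k) = ?g (nxt N k)"
    if "k \<in> half_edges N" for k
  proof -
    obtain h where h: "h \<in> half_edges M" "k = g h"
      using fg(2) \<open>k \<in> half_edges N\<close> by (auto simp: bij_betw_def)
    show ?thesis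
      using h fg(3) f g nxt_in_half_edges[OF M(1) h(1)] opp_in_half_edges[OF M(1) h(1)] by simp
  qed
  moreover have "root M = map_corner ?f ?g (root N)"
    using M fg(4) f g by (auto simp: corners_def nxt_in_half_edges)
  ultimately show ?thesis
    unfolding rooted_iso_def
    using bij_betw_inv_into[OF fg(1)] bij_betw_inv_into[OF fg(2)] by blast
qed

lemma equiv_rooted_iso:
  "equiv (map_representatives n)
     {(M, N). M \<in> map_representatives n \<and> N \<in> map_representatives n \<and> rooted_iso M N}"
  by (intro equivI refl_onI symI transI)
    (auto simp: map_representatives_def intro: rooted_iso_refl rooted_iso_sym rooted_iso_trans)

lemma card_leaves_cong:
  assumes "is_rooted_map M" "is_rooted_map N" "rooted_iso M N"
  shows "card (leaves M) = card (leaves N)"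
proof -
  interpret fin_digraph "graph M" using assms(1) by (simp add: is_rooted_map_def is_map_def)
  obtain f g where fg:
    "bij_betw f (vertices M) (vertices N)" "bij_betw g (half_edges M) (half_edges N)"
    "\<forall>h\<in>half_edges M. tail (graph N) (g h) = f (tail (graph M) h)"
    using assms(3) unfolding rooted_iso_def by blast
  have "half_edges_at N (f v) = g ` half_edges_at M v" if "v \<in> vertices M" for v
  proof -
    have *: "f (tail (graph M) h) = f v \<longleftrightarrow> tail (graph M) h = v" if "h \<in> half_edges M" for h
      using fg(1) that \<open>v \<in> vertices M\<close> by (auto simp: bij_betw_def inj_on_eq_iff)
    have "half_edges N = g ` half_edges M" using fg(2) by (simp add: bij_betw_def)
    then show ?thesis using fg(3) * by (auto simp: out_arcs_def)
  qed
  moreover have "inj_on g (half_edges_at M v)" for v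
    using fg(2) by (auto simp: bij_betw_def intro: inj_on_subset)
  ultimately have deg: "vertex_degree N (f v) = vertex_degree M v" if "v \<in> vertices M" for v
    using that by (simp add: vertex_degree_def card_image)
  have "f ` leaves M = leaves N"
    using bij_betw_imp_surj_on[OF fg(1), symmetric] deg by (auto simp: leaves_def)
  moreover have "inj_on f (leaves M)"
    using fg(1) by (auto simp: bij_betw_def leaves_def intro: inj_on_subset)
  ultimately show ?thesis by (metis card_image)
qed

lemma num_leaves_eq:
  assumes "C \<in> rooted_maps n" "M \<in> C"
  shows "num_leaves C = card (leaves M)"
proof -
  let ?N = "SOME N. N \<in> C"
  have "?N \<in> C" using assms(2) by (rule someI)
  then have "(M, ?N) \<in> {(M, N). M \<in> map_representatives n \<and> N \<in> map_representatives n \<and> rooted_iso M N}"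
    using assms equiv_rooted_iso[of n] unfolding rooted_maps_def
    by (meson quotient_eq_iff)
  then show ?thesis
    using card_leaves_cong[of M ?N] by (auto simp: num_leaves_def map_representatives_def)
qed

end

theory Submission
  imports Defs "HOL-Real_Asymp.Real_Asymp"
begin

text \<open>
  Label the half-edges of a map with \<open>n\<close> edges by \<open>{..<2 * n}\<close> so that the two halves of an edge
  are \<open>2 * i\<close> and \<open>2 * i + 1\<close>. A rooted map then becomes a permutation \<open>\<sigma>\<close> of the labels, jointly
  transitive with the edge involution, together with a root label. Relabelling acts freely on these
  pairs, because a relabelling that fixes the root and commutes with everything is trivial, so each
  rooted map arises from the same number of pairs. Leaves are fixed points of \<open>\<sigma>\<close>. Hence the number
  of leaves is distributed as the number of fixed points of a uniform permutation conditioned on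
  transitivity. An intransitive permutation preserves a union of \<open>k\<close> edges with \<open>0 < k < n\<close>, which has
  probability at most \<open>\<Sum>k. (n choose k) / (2 * n choose (2 * k)) \<le> \<Sum>k. 1 / (n choose k)\<close>, and this
  tends to 0. So the conditioning is asymptotically void, and the number of fixed points of a uniform
  permutation, whose factorial moments are \<open>1\<close>, tends to the Poisson law.
\<close>

section \<open>Fixed points of permutations\<close>

text \<open>Double counting of pairs of a permutation and a \<open>j\<close>-subset \<open>S\<close>
  that it fixes pointwise: the permutations fixing \<open>S\<close> are those of
  \<open>A - S\<close>. Dividing by \<open>fact (card A)\<close> gives the binomial moments of the
  number of fixed points.\<close>

lemma sum_choose_fixed_points:
  assumes "finite A"
  shows "(\<Sum>\<sigma>\<in>{\<sigma>. \<sigma> permutes A}. card {x \<in> A. \<sigma> x = x} choose j) =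
    (card A choose j) * fact (card A - j)"
proof -
  let ?P = "{\<sigma>. \<sigma> permutes A}" and ?T = "{S. S \<subseteq> A \<and> card S = j}"
  have "(\<Sum>\<sigma>\<in>?P. card {x \<in> A. \<sigma> x = x} choose j) =
      (\<Sum>\<sigma>\<in>?P. card {S \<in> ?T. \<forall>x\<in>S. \<sigma> x = x})"
  proof (rule sum.cong[OF refl])
    fix \<sigma>
    have "card {x \<in> A. \<sigma> x = x} choose j = card {S. S \<subseteq> {x \<in> A. \<sigma> x = x} \<and> card S = j}"
      using assms by (simp add: n_subsets)
    also have "{S. S \<subseteq> {x \<in> A. \<sigma> x = x} \<and> card S = j} = {S \<in> ?T. \<forall>x\<in>S. \<sigma> x = x}"
      by auto
    finally show "card {x \<in> A. \<sigma> x = x} choose j = card {S \<in> ?T. \<forall>x\<in>S. \<sigma> x = x}" .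
  qed
  also have "\<dots> = (\<Sum>S\<in>?T. fact (card A - j))"
  proof (rule sum_multicount_gen)
    show "finite ?P" "finite ?T" using assms by (auto intro: finite_permutations)
    show "\<forall>S\<in>?T. card {\<sigma> \<in> ?P. \<forall>x\<in>S. \<sigma> x = x} = fact (card A - j)"
    proof
      fix S assume "S \<in> ?T"
      then have S: "S \<subseteq> A" "card S = j" by auto
      have "{\<sigma> \<in> ?P. \<forall>x\<in>S. \<sigma> x = x} = {\<sigma>. \<sigma> permutes (A - S)}"
        using S(1) by (auto intro: permutes_superset permutes_subset dest: permutes_not_in)
      then show "card {\<sigma> \<in> ?P. \<forall>x\<in>S. \<sigma> x = x} = fact (card A - j)"
        using S assms by (simp add: card_permutations card_Diff_subset finite_subset)
    qed
  qed
  also have "\<dots> = (card A choose j) * fact (card A - j)"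
    using assms by (simp add: n_subsets)
  finally show ?thesis .
qed

text \<open>Binomial inversion. The product of the two binomials is
  \<open>(f choose k) * ((f - k) choose i)\<close>, so an alternating row sum of Pascal's triangle
  remains, which vanishes unless \<open>f = k\<close>. The range depends on \<open>m\<close> instead
  of \<open>f\<close>, so that the sum can be exchanged with one over permutations whose fixed-point
  counts \<open>f\<close> vary.\<close>

lemma indicator_eq_alternating_choose_sum:
  assumes "f \<le> m" "k \<le> m"
  shows "(\<Sum>i\<le>m - k. (-1) ^ i * real ((i + k) choose k) * real (f choose (i + k))) =
    of_bool (f = k)"
proof (cases "k \<le> f")
  case False
  then show ?thesis by (intro trans[OF sum.neutral]) (auto simp: binomial_eq_0)
next
  case True
  have *: "(f choose (i + k)) * ((i + k) choose k) = (f choose k) * ((f - k) choose i)" for i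
  proof (cases "i + k \<le> f")
    case True
    then show ?thesis using choose_mult[of k "i + k" f] by simp
  qed (use True in \<open>auto simp: binomial_eq_0\<close>)
  have "(\<Sum>i\<le>m - k. (-1) ^ i * real ((i + k) choose k) * real (f choose (i + k))) =
      (\<Sum>i\<le>m - k. real (f choose k) * ((-1) ^ i * real ((f - k) choose i)))"
  proof (rule sum.cong[OF refl])
    fix i
    show "(-1) ^ i * real ((i + k) choose k) * real (f choose (i + k)) =
        real (f choose k) * ((-1) ^ i * real ((f - k) choose i))"
      using arg_cong[OF *[of i], of real] by (simp add: algebra_simps)
  qed
  also have "\<dots> = real (f choose k) * (\<Sum>i\<le>m - k. (-1) ^ i * real ((f - k) choose i))"
    by (simp add: sum_distrib_left)
  also have "(\<Sum>i\<le>m - k. (-1) ^ i * real ((f - k) choose i)) =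
      (\<Sum>i\<le>f - k. (-1) ^ i * real ((f - k) choose i))"
    using assms by (intro sum.mono_neutral_right) (auto simp: binomial_eq_0)
  also have "real (f choose k) * \<dots> = of_bool (f = k)"
    using True choose_alternating_sum[of "f - k", where ?'a = real] by (cases "f = k") auto
  finally show ?thesis .
qed

text \<open>These are the rencontres numbers. The indicator of having \<open>k\<close> fixed points
  is expanded in binomials, whose sums over all permutations are known from
  \<open>sum_choose_fixed_points\<close>.\<close>

lemma card_permutes_fixed_points:
  assumes "finite A" "k \<le> card A"
  shows "real (card {\<sigma>. \<sigma> permutes A \<and> card {x \<in> A. \<sigma> x = x} = k}) / fact (card A) =
    (\<Sum>i\<le>card A - k. (-1) ^ i / fact i) / fact k"
proof -
  let ?P = "{\<sigma>. \<sigma> permutes A}" and ?m = "card A"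
  let ?f = "\<lambda>\<sigma>. card {x \<in> A. \<sigma> x = x}"
  have fin: "finite ?P" using assms by (simp add: finite_permutations)
  have "real (card {\<sigma>. \<sigma> permutes A \<and> ?f \<sigma> = k}) = (\<Sum>\<sigma>\<in>?P. of_bool (?f \<sigma> = k))"
    using fin by (simp add: of_bool_def sum.If_cases Int_def)
  also have "\<dots> = (\<Sum>\<sigma>\<in>?P. \<Sum>i\<le>?m - k.
      (-1) ^ i * real ((i + k) choose k) * real (?f \<sigma> choose (i + k)))"
    using assms by (intro sum.cong refl indicator_eq_alternating_choose_sum[symmetric])
      (auto intro: card_mono)
  also have "\<dots> = (\<Sum>i\<le>?m - k. (-1) ^ i * real ((i + k) choose k) *
      real (\<Sum>\<sigma>\<in>?P. ?f \<sigma> choose (i + k)))"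
    by (subst sum.swap) (simp add: sum_distrib_left)
  also have "\<dots> = (\<Sum>i\<le>?m - k. (-1) ^ i / fact i / fact k * fact ?m)"
  proof (rule sum.cong[OF refl])
    fix i assume "i \<in> {..?m - k}"
    then have le: "i + k \<le> ?m" using assms by auto
    have "real ((?m choose (i + k)) * fact (?m - (i + k))) = fact ?m / fact (i + k)"
      using le by (simp add: binomial_fact)
    moreover have "real ((i + k) choose k) = fact (i + k) / (fact k * fact i)"
      by (simp add: binomial_fact)
    ultimately have "(-1) ^ i * real ((i + k) choose k) * real (\<Sum>\<sigma>\<in>?P. ?f \<sigma> choose (i + k)) =
        (-1) ^ i * (fact (i + k) / (fact k * fact i)) * (fact ?m / fact (i + k))"
      unfolding sum_choose_fixed_points[OF assms(1)] by (simp only:)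
    then show "(-1) ^ i * real ((i + k) choose k) * real (\<Sum>\<sigma>\<in>?P. ?f \<sigma> choose (i + k)) =
        (-1) ^ i / fact i / fact k * fact ?m"
      by simp
  qed
  also have "\<dots> = (\<Sum>i\<le>?m - k. (-1) ^ i / fact i) / fact k * fact ?m"
    by (simp add: sum_distrib_right sum_divide_distrib)
  finally show ?thesis by simp
qed

lemma fixed_points_limit:
  "(\<lambda>m. real (card {\<sigma>. \<sigma> permutes {..<m} \<and> card {x \<in> {..<m}. \<sigma> x = x} = k}) / fact m)
     \<longlonglongrightarrow> exp (-1) / fact k"
proof -
  have "(\<lambda>m. \<Sum>i\<le>m. (-1) ^ i / fact i :: real) \<longlonglongrightarrow> exp (-1)"
    using exp_converges[of "-1 :: real"]
    by (simp add: sums_def_le divide_inverse mult.commute)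
  then have "(\<lambda>m. (\<Sum>i\<le>m - k. (-1) ^ i / fact i :: real) / fact k) \<longlonglongrightarrow> exp (-1) / fact k"
    by (intro tendsto_intros filterlim_compose[OF _ filterlim_minus_const_nat_at_top]) auto
  moreover have "eventually (\<lambda>m. (\<Sum>i\<le>m - k. (-1) ^ i / fact i) / fact k =
      real (card {\<sigma>. \<sigma> permutes {..<m} \<and> card {x \<in> {..<m}. \<sigma> x = x} = k}) / fact m) sequentially"
    using eventually_ge_at_top[of k]
    by eventually_elim (use card_permutes_fixed_points[of "{..<m}" k for m :: nat] in auto)
  ultimately show ?thesis by (rule Lim_transform_eventually)
qed

section \<open>Transitivity\<close>

text \<open>For permutations of a finite set, the subsets closed under \<open>f\<close> and
  \<open>g\<close> are the unions of orbits of the group they generate, so this is transitivity of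
  that group. In this form it works as an induction principle: a closed property that holds at one
  point holds on all of \<open>H\<close>.\<close>

definition transitive_on :: "('h \<Rightarrow> 'h) \<Rightarrow> ('h \<Rightarrow> 'h) \<Rightarrow> 'h set \<Rightarrow> bool" where
  "transitive_on f g H \<longleftrightarrow> (\<forall>U\<subseteq>H. U \<noteq> {} \<longrightarrow> f ` U \<subseteq> U \<longrightarrow> g ` U \<subseteq> U \<longrightarrow> U = H)"

lemma transitive_onD:
  assumes "transitive_on f g H" "x \<in> U" "U \<subseteq> H" "f ` U \<subseteq> U" "g ` U \<subseteq> U"
  shows "U = H"
  using assms unfolding transitive_on_def by blast

text \<open>Outside \<open>{..<2 * n}\<close> it is the identity, as \<^const>\<open>bidirected_digraph\<close> requires.\<close>

definition mate :: "nat \<Rightarrow> nat \<Rightarrow> nat" where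
  "mate n h = (if h < 2 * n then if even h then h + 1 else h - 1 else h)"

section \<open>Rarity of intransitive permutations\<close>

text \<open>By finiteness such a permutation maps \<open>U\<close> onto \<open>U\<close>, hence also
  \<open>A - U\<close> onto itself, and it is determined by its restrictions to these two
  sets.\<close>

lemma card_permutes_invariant:
  assumes "finite A" "U \<subseteq> A"
  shows "card {\<sigma>. \<sigma> permutes A \<and> \<sigma> ` U \<subseteq> U} \<le> fact (card U) * fact (card A - card U)"
proof -
  let ?r = "\<lambda>\<sigma>. (perm_restrict \<sigma> U, perm_restrict \<sigma> (A - U))"
  have fin: "finite U" using assms finite_subset by blast
  have "inj_on ?r {\<sigma>. \<sigma> permutes A \<and> \<sigma> ` U \<subseteq> U}"
  proof (rule inj_onI, rule ext)
    fix \<sigma> \<tau> x assume *: "\<sigma> \<in> {\<sigma>. \<sigma> permutes A \<and> \<sigma> ` U \<subseteq> U}" "\<tau> \<in> {\<sigma>. \<sigma> permutes A \<and> \<sigma> ` U \<subseteq> U}"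
      "?r \<sigma> = ?r \<tau>"
    then have "perm_restrict \<sigma> U x = perm_restrict \<tau> U x"
      "perm_restrict \<sigma> (A - U) x = perm_restrict \<tau> (A - U) x" by auto
    then show "\<sigma> x = \<tau> x"
      using * by (cases "x \<in> A"; cases "x \<in> U") (auto simp: perm_restrict_def permutes_not_in)
  qed
  moreover have "?r ` {\<sigma>. \<sigma> permutes A \<and> \<sigma> ` U \<subseteq> U} \<subseteq> {\<sigma>. \<sigma> permutes U} \<times> {\<sigma>. \<sigma> permutes (A - U)}"
  proof (clarsimp, intro conjI)
    fix \<sigma> assume \<sigma>: "\<sigma> permutes A" "\<sigma> ` U \<subseteq> U"
    have inj: "inj_on \<sigma> V" for V using \<sigma>(1) by (meson permutes_inj_on)
    have U: "\<sigma> ` U = U" using fin \<sigma>(2) inj by (simp add: endo_inj_surj)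
    have AU: "\<sigma> ` (A - U) = A - U"
      using permutes_image[OF \<sigma>(1)] U permutes_inj[OF \<sigma>(1)] by (simp add: image_set_diff)
    have "bij_betw (perm_restrict \<sigma> V) V V" if "\<sigma> ` V = V" for V
      using that inj by (subst bij_betw_cong[of _ _ \<sigma>]) (auto simp: perm_restrict_def bij_betw_def)
    then show "perm_restrict \<sigma> U permutes U" "perm_restrict \<sigma> (A - U) permutes (A - U)"
      using U AU by (auto intro!: bij_imp_permutes simp: perm_restrict_def)
  qed
  ultimately have "card {\<sigma>. \<sigma> permutes A \<and> \<sigma> ` U \<subseteq> U} \<le>
      card ({\<sigma>. \<sigma> permutes U} \<times> {\<sigma>. \<sigma> permutes (A - U)})"
    using assms fin by (intro card_inj_on_le) (auto intro: finite_permutations)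
  also have "\<dots> = fact (card U) * fact (card A - card U)"
    using assms fin by (simp add: card_cartesian_product card_permutations card_Diff_subset)
  finally show ?thesis .
qed

text \<open>The union of the edges with index in \<open>T\<close>, edge \<open>i\<close> having the
  halves \<open>2 * i\<close> and \<open>2 * i + 1\<close>.\<close>

definition halves :: "nat set \<Rightarrow> nat set" where
  "halves T = {h. h div 2 \<in> T}"

lemma card_halves:
  assumes "finite T"
  shows "finite (halves T)" "card (halves T) = 2 * card T"
proof -
  have *: "halves T = (\<lambda>i. 2 * i) ` T \<union> (\<lambda>i. 2 * i + 1) ` T"
  proof (intro equalityI subsetI)
    fix h assume "h \<in> halves T"
    then have "h div 2 \<in> T" by (simp add: halves_def)
    moreover have "h = 2 * (h div 2) \<or> h = 2 * (h div 2) + 1" by presburger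
    ultimately show "h \<in> (\<lambda>i. 2 * i) ` T \<union> (\<lambda>i. 2 * i + 1) ` T" by blast
  qed (auto simp: halves_def)
  then show "finite (halves T)" using assms by simp
  have "(\<lambda>i. 2 * i) ` T \<inter> (\<lambda>i. 2 * i + 1) ` T = {}" by (auto, presburger)
  then show "card (halves T) = 2 * card T"
    using assms unfolding * by (subst card_Un_disjoint) (auto simp: card_image inj_on_def)
qed

text \<open>The witness \<open>T\<close> consists of the indices of the edges that \<open>U\<close>
  meets. Two labels with the same index are equal or mates, so \<open>U\<close> contains both halves
  of each of these edges.\<close>

lemma mate_invariantE:
  assumes "U \<subseteq> {..<2 * n}" "mate n ` U \<subseteq> U"
  obtains T where "T \<subseteq> {..<n}" "U = halves T"
proof
  show "(\<lambda>h. h div 2) ` U \<subseteq> {..<n}" using assms(1) by auto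
  show "U = halves ((\<lambda>h. h div 2) ` U)"
  proof (intro equalityI subsetI)
    fix h assume "h \<in> halves ((\<lambda>h. h div 2) ` U)"
    then obtain k where k: "k \<in> U" "h div 2 = k div 2" by (auto simp: halves_def)
    then have "h = k \<or> h = mate n k"
      using assms(1) unfolding mate_def by (auto simp: subset_iff) presburger+
    then show "h \<in> U" using k(1) assms(2) by auto
  qed (auto simp: halves_def)
qed

text \<open>The square is the middle term of Vandermonde's convolution for
  \<open>2 * n choose (2 * k)\<close>.\<close>

lemma choose_square_le: "(n choose k)\<^sup>2 \<le> 2 * n choose (2 * k)"
proof -
  have "(n choose k)\<^sup>2 = (n choose k) * (n choose (2 * k - k))" by (simp add: power2_eq_square)
  also have "\<dots> \<le> (\<Sum>j\<le>2 * k. (n choose j) * (n choose (2 * k - j)))"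
    by (rule member_le_sum[of k]) auto
  finally show ?thesis by (simp add: vandermonde flip: mult_2)
qed

text \<open>Union bound over the edge sets \<open>T\<close> with \<open>k\<close> elements. A
  proportion of at most \<open>1 / (2 * n choose (2 * k))\<close> of all permutations preserves
  \<open>halves T\<close>; there are \<open>n choose k\<close> choices of \<open>T\<close>, and
  \<open>choose_square_le\<close> cancels this factor.\<close>

lemma card_not_transitive:
  "real (card {\<sigma>. \<sigma> permutes {..<2 * n} \<and> \<not> transitive_on \<sigma> (mate n) {..<2 * n}}) / fact (2 * n) \<le>
     (\<Sum>k\<in>{0<..<n}. 1 / real (n choose k))"
proof -
  let ?N = "{\<sigma>. \<sigma> permutes {..<2 * n} \<and> \<not> transitive_on \<sigma> (mate n) {..<2 * n}}"
  let ?I = "\<lambda>T. {\<sigma>. \<sigma> permutes {..<2 * n} \<and> \<sigma> ` halves T \<subseteq> halves T}"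
  let ?T = "\<lambda>k. {T. T \<subseteq> {..<n} \<and> card T = k}"
  have sub: "?N \<subseteq> (\<Union>k\<in>{0<..<n}. \<Union>T\<in>?T k. ?I T)"
  proof
    fix \<sigma> assume "\<sigma> \<in> ?N"
    then obtain U where U: "\<sigma> permutes {..<2 * n}" "U \<subseteq> {..<2 * n}" "U \<noteq> {}" "\<sigma> ` U \<subseteq> U"
      "mate n ` U \<subseteq> U" "U \<noteq> {..<2 * n}"
      by (auto simp: transitive_on_def)
    obtain T where T: "T \<subseteq> {..<n}" "U = halves T" using U mate_invariantE by metis
    have fin: "finite T" using T finite_subset by blast
    \<comment> \<open>\<open>U\<close> is nonempty and proper and has \<open>2 * card T\<close>
      elements, which gives the strict bounds on \<open>card T\<close>.\<close>
    have "card U \<noteq> 0" using U(3) fin T(2) card_halves(1)[OF fin] by auto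
    moreover have "card U < 2 * n" using U(2,6) psubset_card_mono[of "{..<2 * n}" U] by auto
    ultimately have "card T \<in> {0<..<n}" using card_halves(2)[OF fin] T(2) by auto
    then show "\<sigma> \<in> (\<Union>k\<in>{0<..<n}. \<Union>T\<in>?T k. ?I T)" using T U by blast
  qed
  have fin: "finite (?I T)" for T by (rule finite_subset[OF _ finite_permutations[of "{..<2 * n}"]]) auto
  have I: "card (?I T) \<le> fact (2 * k) * fact (2 * n - 2 * k)" if "T \<in> ?T k" for T k
  proof -
    have T: "finite T" "card T = k" "halves T \<subseteq> {..<2 * n}"
      using that by (auto intro: finite_subset simp: halves_def)
    then show ?thesis
      using card_permutes_invariant[of "{..<2 * n}" "halves T"] card_halves[of T] by auto
  qed
  have "card ?N \<le> card (\<Union>k\<in>{0<..<n}. \<Union>T\<in>?T k. ?I T)"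
    using sub by (rule card_mono[rotated]) (auto intro: fin)
  also have "\<dots> \<le> (\<Sum>k\<in>{0<..<n}. card (\<Union>T\<in>?T k. ?I T))"
    by (rule card_UN_le) auto
  also have "\<dots> \<le> (\<Sum>k\<in>{0<..<n}. \<Sum>T\<in>?T k. card (?I T))"
    by (intro sum_mono card_UN_le) auto
  also have "\<dots> \<le> (\<Sum>k\<in>{0<..<n}. \<Sum>T\<in>?T k. fact (2 * k) * fact (2 * n - 2 * k))"
    by (intro sum_mono I)
  also have "\<dots> = (\<Sum>k\<in>{0<..<n}. (n choose k) * (fact (2 * k) * fact (2 * n - 2 * k)))"
    by (simp add: n_subsets)
  finally have "real (card ?N) / fact (2 * n) \<le>
      real (\<Sum>k\<in>{0<..<n}. (n choose k) * (fact (2 * k) * fact (2 * n - 2 * k))) / fact (2 * n)"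
    by (intro divide_right_mono) (auto simp del: of_nat_sum)
  also have "\<dots> = (\<Sum>k\<in>{0<..<n}. real (n choose k) * (fact (2 * k) * fact (2 * n - 2 * k)) / fact (2 * n))"
    by (simp add: sum_divide_distrib)
  also have "\<dots> \<le> (\<Sum>k\<in>{0<..<n}. 1 / real (n choose k))"
  proof (rule sum_mono)
    fix k assume k: "k \<in> {0<..<n}"
    have pos: "0 < real (n choose k)" using k by simp
    have "real (n choose k) * (fact (2 * k) * fact (2 * n - 2 * k)) / fact (2 * n) =
        real (n choose k) / real (2 * n choose (2 * k))"
      using k by (simp add: binomial_fact)
    also have "\<dots> \<le> real (n choose k) / real ((n choose k)\<^sup>2)"
      using pos choose_square_le[of n k] by (intro divide_left_mono) (auto simp del: of_nat_power)
    also have "\<dots> = 1 / real (n choose k)" by (simp add: power2_eq_square)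
    finally show "real (n choose k) * (fact (2 * k) * fact (2 * n - 2 * k)) / fact (2 * n) \<le>
      1 / real (n choose k)" .
  qed
  finally show ?thesis .
qed

text \<open>A row of Pascal's triangle increases up to its middle; beyond the middle,
  \<open>k\<close> is replaced by \<open>n - k\<close>.\<close>

lemma choose_2_le_choose:
  assumes "2 \<le> k" "k + 2 \<le> n"
  shows "n choose 2 \<le> n choose k"
proof (cases "2 * k \<le> n")
  case True
  then show ?thesis using assms by (intro binomial_mono)
next
  case False
  then have "n choose 2 \<le> n choose (n - k)" using assms by (intro binomial_mono) auto
  then show ?thesis using assms by (simp add: binomial_symmetric[of k n])
qed

text \<open>The two extreme terms contribute \<open>1 / n\<close> each. The fewer than
  \<open>n\<close> others are at most \<open>1 / (n choose 2)\<close> each, so the whole sum is of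
  order \<open>1 / n\<close>.\<close>

lemma sum_inverse_choose_tendsto_0: "(\<lambda>n. \<Sum>k\<in>{0<..<n}. 1 / real (n choose k)) \<longlonglongrightarrow> 0"
proof (rule tendsto_sandwich[of "\<lambda>_. 0"])
  show "(\<lambda>n. 2 / real n + real n / real (n choose 2)) \<longlonglongrightarrow> 0"
  proof -
    have choose_2: "real (n choose 2) = real n * (real n - 1) / 2" for n
      by (induction n) (auto simp: numeral_2_eq_2 field_simps)
    show ?thesis unfolding choose_2 by real_asymp
  qed
  show "\<forall>\<^sub>F n in sequentially. (\<Sum>k\<in>{0<..<n}. 1 / real (n choose k)) \<le>
      2 / real n + real n / real (n choose 2)"
    \<comment> \<open>From 4 on, the indices \<open>1\<close> and \<open>n - 1\<close> are distinct
      and the range \<open>{2..n - 2}\<close> between them is nonempty.\<close>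
    using eventually_ge_at_top[of 4]
  proof eventually_elim
    case (elim n)
    have "{0<..<n} = {1, n - 1} \<union> {2..n - 2}" using elim by auto
    then have "(\<Sum>k\<in>{0<..<n}. 1 / real (n choose k)) =
        (\<Sum>k\<in>{1, n - 1}. 1 / real (n choose k)) + (\<Sum>k\<in>{2..n - 2}. 1 / real (n choose k))"
      using elim by (simp only:) (rule sum.union_disjoint, auto)
    also have "(\<Sum>k\<in>{1, n - 1}. 1 / real (n choose k)) = 2 / real n"
      using elim binomial_symmetric[of 1 n] by simp
    also have "(\<Sum>k\<in>{2..n - 2}. 1 / real (n choose k)) \<le> (\<Sum>k\<in>{2..n - 2}. 1 / real (n choose 2))"
      using elim by (intro sum_mono divide_left_mono mult_pos_pos)
        (auto simp: choose_2_le_choose)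
    also have "\<dots> \<le> real n / real (n choose 2)"
      using elim by (auto intro!: divide_right_mono)
    finally show ?case by simp
  qed
qed (auto intro!: always_eventually sum_nonneg)

section \<open>Maps and permutations\<close>

lemma mate_simps [simp]:
  "mate n (mate n h) = h"
  "mate n h = h \<longleftrightarrow> \<not> h < 2 * n"
  "mate n h < 2 * n \<longleftrightarrow> h < 2 * n"
  unfolding mate_def by presburger+

text \<open>Connectedness is defined through the symmetric closure. Since every arc has a reversed
  arc, the closure leaves reachability unchanged.\<close>

lemma (in bidirected_digraph) connected_iff:
  "Digraph_Component.connected G \<longleftrightarrow> strongly_connected G"
proof -
  have "symmetric G"
    unfolding symmetric_conv using arev_in_arcs tail_arev head_arev by metis
  then show ?thesis
    by (simp add: connected_def strongly_connected_def reachable_mk_symmetric_eq)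
qed

section \<open>Vertices, edges and leaves in terms of \<open>nxt\<close> and
  \<open>opp\<close>\<close>

lemma is_map_cyclic_on:
  assumes "is_map M" "h \<in> half_edges M"
  shows "cyclic_on (nxt M) (half_edges_at M (tail (graph M) h))"
proof -
  interpret fin_digraph "graph M" using assms by (simp add: is_map_def)
  have "h \<in> half_edges_at M (tail (graph M) h)" using assms(2) by simp
  moreover have "tail (graph M) h \<in> vertices M" using assms(2) by (rule tail_in_verts)
  ultimately show ?thesis using assms(1) unfolding is_map_def by blast
qed

text \<open>Vertices with half-edges thus correspond to the cycles of \<open>nxt\<close>, which lets
  the permutation alone carry the vertex structure.\<close>

lemma orbit_nxt:
  assumes "is_map M" "h \<in> half_edges M"
  shows "orbit (nxt M) h = half_edges_at M (tail (graph M) h)"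
  using is_map_cyclic_on[OF assms] by (rule orbit_cyclic_eq3) (use assms in simp)

text \<open>A closed set contains with a half-edge its whole \<open>nxt\<close>-orbit, that is, all
  half-edges at its vertex, and \<open>opp\<close> leads on to the adjacent vertices. Induction
  along paths from one vertex then reaches every half-edge.\<close>

lemma is_map_transitive_on:
  assumes "is_map M"
  shows "transitive_on (nxt M) (opp M) (half_edges M)"
  unfolding transitive_on_def
proof (intro allI impI)
  fix U assume U: "U \<subseteq> half_edges M" "U \<noteq> {}" "nxt M ` U \<subseteq> U" "opp M ` U \<subseteq> U"
  interpret fin_digraph "graph M" using assms by (simp add: is_map_def)
  interpret bidirected_digraph "graph M" "opp M" using assms by (simp add: is_map_def)
  have at: "half_edges_at M (tail (graph M) h) \<subseteq> U" if "h \<in> U" for h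
  proof
    fix k assume "k \<in> half_edges_at M (tail (graph M) h)"
    then have "k \<in> orbit (nxt M) h" using orbit_nxt[OF assms] that U(1) by blast
    then show "k \<in> U" using that U(3) by induction auto
  qed
  obtain h where h: "h \<in> U" using U(2) by blast
  have "half_edges_at M v \<subseteq> U" if "tail (graph M) h \<rightarrow>\<^sup>*\<^bsub>graph M\<^esub> v" for v
    using that
  proof (induction rule: reachable_induct)
    case base
    show ?case using h by (rule at)
  next
    case (step v w)
    then obtain e where e: "e \<in> half_edges M" "tail (graph M) e = v" "head (graph M) e = w"
      by (auto simp: arcs_ends_conv)
    then have "e \<in> U" using step.IH by auto
    then have "opp M e \<in> U" using U(4) by auto
    then show ?case using at[of "opp M e"] e by simp
  qed
  moreover have "tail (graph M) h \<rightarrow>\<^sup>*\<^bsub>graph M\<^esub> tail (graph M) k" if "k \<in> half_edges M" for k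
  proof -
    have "tail (graph M) h \<in> vertices M" "tail (graph M) k \<in> vertices M"
      using h U(1) that by auto
    then show ?thesis using assms connected_iff unfolding is_map_def strongly_connected_def by blast
  qed
  ultimately have "half_edges M \<subseteq> U" by (force simp: out_arcs_def)
  then show "U = half_edges M" using U(1) by blast
qed

text \<open>Connectedness excludes isolated vertices once there is a half-edge: a vertex reached by
  a nontrivial path is the tail of the reverse of the last arc.\<close>

lemma vertices_eq_tails:
  assumes "is_map M" "half_edges M \<noteq> {}"
  shows "vertices M = tail (graph M) ` half_edges M"
proof -
  interpret fin_digraph "graph M" using assms by (simp add: is_map_def)
  interpret bidirected_digraph "graph M" "opp M" using assms by (simp add: is_map_def)
  obtain h where h: "h \<in> half_edges M" using assms(2) by blast
  have "v \<in> tail (graph M) ` half_edges M" if "tail (graph M) h \<rightarrow>\<^sup>*\<^bsub>graph M\<^esub> v" for v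
    using that
  proof (induction rule: reachable_induct)
    case (step v w)
    then obtain e where e: "e \<in> half_edges M" "head (graph M) e = w"
      by (auto simp: arcs_ends_conv)
    then show ?case by (metis tail_arev arev_in_arcs image_eqI)
  qed (use h in auto)
  moreover have "tail (graph M) h \<rightarrow>\<^sup>*\<^bsub>graph M\<^esub> v" if "v \<in> vertices M" for v
    using assms that h connected_iff unfolding is_map_def strongly_connected_def by auto
  ultimately show ?thesis by auto
qed

lemma card_half_edges:
  assumes "is_map M"
  shows "card (half_edges M) = 2 * card (edges M)"
proof -
  interpret fin_digraph "graph M" using assms by (simp add: is_map_def)
  interpret bidirected_digraph "graph M" "opp M" using assms by (simp add: is_map_def)
  have *: "\<Union>(edges M) = half_edges M" by (auto simp: edges_def)
  have "2 * card (edges M) = card (\<Union>(edges M))"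
  proof (rule card_partition)
    show "finite (edges M)" by (simp add: edges_def)
    show "finite (\<Union>(edges M))" by (simp add: *)
    show "card c = 2" if "c \<in> edges M" for c
      using that by (auto simp: edges_def card_2_iff) (metis arev_neq)
    show "c1 \<inter> c2 = {}" if "c1 \<in> edges M" "c2 \<in> edges M" "c1 \<noteq> c2" for c1 c2
      using that by (auto simp: edges_def arev_eq_iff)
  qed
  then show ?thesis by (simp add: *)
qed

text \<open>A fixed point of \<open>nxt\<close> is a half-edge whose orbit, and hence whose set of
  companions at its vertex, is a singleton. Taking tails is therefore a bijection from fixed points
  to leaves.\<close>

lemma card_leaves:
  assumes "is_map M"
  shows "card (leaves M) = card {h \<in> half_edges M. nxt M h = h}"
proof -
  interpret fin_digraph "graph M" using assms by (simp add: is_map_def)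
  let ?t = "tail (graph M)"
  have fixed: "nxt M h = h \<longleftrightarrow> half_edges_at M (?t h) = {h}" if "h \<in> half_edges M" for h
    using orbit_nxt[OF assms that] orbit_eq_singleton_iff by metis
  have "bij_betw ?t {h \<in> half_edges M. nxt M h = h} (leaves M)"
  proof (rule bij_betw_imageI)
    show "inj_on ?t {h \<in> half_edges M. nxt M h = h}"
      by (rule inj_onI) (use fixed in auto)
    show "?t ` {h \<in> half_edges M. nxt M h = h} = leaves M"
    proof (intro equalityI subsetI)
      fix v assume "v \<in> leaves M"
      then obtain h where "half_edges_at M v = {h}"
        by (auto simp: leaves_def vertex_degree_def card_1_singleton_iff)
      then have "h \<in> half_edges M" "?t h = v" by (auto simp: out_arcs_def)
      then show "v \<in> ?t ` {h \<in> half_edges M. nxt M h = h}"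
        using \<open>half_edges_at M v = {h}\<close> fixed by auto
    qed (use fixed in \<open>auto simp: leaves_def vertex_degree_def\<close>)
  qed
  then show ?thesis by (simp add: bij_betw_same_card)
qed

text \<open>With a half-edge present no vertex is isolated, so no corner has the form
  \<open>Around v\<close>.\<close>

lemma root_cases:
  assumes "is_rooted_map M" "half_edges M \<noteq> {}"
  obtains h where "h \<in> half_edges M" "root M = Between h (nxt M h)"
proof -
  have "vertices M = tail (graph M) ` half_edges M"
    using assms by (intro vertices_eq_tails) (auto simp: is_rooted_map_def)
  then have "{v \<in> vertices M. half_edges_at M v = {}} = {}" by auto
  then have "corners M = (\<lambda>h. Between h (nxt M h)) ` half_edges M"
    unfolding corners_def by (simp only: image_empty Un_empty_left)
  then show ?thesis using assms(1) that unfolding is_rooted_map_def by blast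
qed

section \<open>Isomorphisms from bijections of half-edges\<close>

text \<open>A bijection of half-edges that intertwines \<open>nxt\<close> carries orbits to orbits.
  Since vertices are such orbits, it induces the required bijection of vertices.\<close>

lemma rooted_isoI:
  assumes M: "is_map M" and N: "is_map N" and h: "h \<in> half_edges M"
    and g: "bij_betw g (half_edges M) (half_edges N)"
    and opp: "\<And>k. k \<in> half_edges M \<Longrightarrow> opp N (g k) = g (opp M k)"
    and nxt: "\<And>k. k \<in> half_edges M \<Longrightarrow> nxt N (g k) = g (nxt M k)"
    and root: "root M = Between h (nxt M h)" "root N = Between (g h) (nxt N (g h))"
  shows "rooted_iso M N"
proof -
  let ?s = "tail (graph M)" and ?t = "tail (graph N)"
  have ne: "half_edges M \<noteq> {}" "half_edges N \<noteq> {}" using h g by (auto simp: bij_betw_def)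
  have gN: "g k \<in> half_edges N" if "k \<in> half_edges M" for k
    using g that by (auto simp: bij_betw_def)
  have inj: "inj_on g (half_edges M)" using g by (simp add: bij_betw_def)
  have tails: "?t (g k) = ?t (g l) \<longleftrightarrow> ?s k = ?s l" if kl: "k \<in> half_edges M" "l \<in> half_edges M" for k l
  proof -
    have sub: "orbit (nxt M) k \<subseteq> half_edges M" using orbit_nxt[OF M kl(1)] by auto
    have "k \<in> orbit (nxt M) k" using orbit_nxt[OF M kl(1)] kl by simp
    then have im: "g ` orbit (nxt M) k = orbit (nxt N) (g k)"
      by (rule orbit_inverse) (use sub nxt in auto)
    have "?t (g k) = ?t (g l) \<longleftrightarrow> g l \<in> orbit (nxt N) (g k)"
      using orbit_nxt[OF N gN[OF kl(1)]] gN kl by auto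
    also have "\<dots> \<longleftrightarrow> l \<in> orbit (nxt M) k"
      unfolding im[symmetric] using inj sub kl by (auto simp: inj_on_eq_iff dest: inj_onD)
    also have "\<dots> \<longleftrightarrow> ?s k = ?s l" using orbit_nxt[OF M kl(1)] kl by auto
    finally show ?thesis .
  qed
  \<comment> \<open>Any half-edge at \<open>v\<close> may be chosen: by \<open>tails\<close>, the
    vertex of its image depends only on \<open>v\<close>.\<close>
  define f where "f v = ?t (g (SOME k. k \<in> half_edges M \<and> ?s k = v))" for v
  have f: "f (?s k) = ?t (g k)" if "k \<in> half_edges M" for k
  proof -
    have "(SOME l. l \<in> half_edges M \<and> ?s l = ?s k) \<in> half_edges M \<and>
        ?s (SOME l. l \<in> half_edges M \<and> ?s l = ?s k) = ?s k"
      by (rule someI[of "\<lambda>l. l \<in> half_edges M \<and> ?s l = ?s k" k]) (use that in simp)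
    then show ?thesis using tails that unfolding f_def by blast
  qed
  have "bij_betw f (vertices M) (vertices N)"
  proof (rule bij_betw_imageI)
    show "inj_on f (vertices M)"
      unfolding vertices_eq_tails[OF M ne(1)] by (rule inj_onI) (use f tails in auto)
    have "f ` vertices M = (\<lambda>k. ?t (g k)) ` half_edges M"
      unfolding vertices_eq_tails[OF M ne(1)] image_image using f by (intro image_cong) auto
    also have "\<dots> = vertices N"
      unfolding vertices_eq_tails[OF N ne(2)] using g by (simp add: bij_betw_def flip: image_image)
    finally show "f ` vertices M = vertices N" .
  qed
  then show ?thesis
    unfolding rooted_iso_def using g opp nxt root f h
    by (intro exI[of _ f] exI[of _ g]) simp
qed

text \<open>Induction on the set: match one pair \<open>{x, a x}\<close> with one pair
  \<open>{y, b y}\<close>, remove both, and extend the bijection obtained for the rest. This makes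
  the standard labelling of half-edges available for every map.\<close>

lemma fixpoint_free_involution_iso:
  fixes a :: "'a \<Rightarrow> 'a" and b :: "'b \<Rightarrow> 'b"
  assumes "finite A" "finite B" "card A = card B"
    and "\<And>x. x \<in> A \<Longrightarrow> a x \<in> A \<and> a x \<noteq> x \<and> a (a x) = x"
    and "\<And>y. y \<in> B \<Longrightarrow> b y \<in> B \<and> b y \<noteq> y \<and> b (b y) = y"
  shows "\<exists>g. bij_betw g A B \<and> (\<forall>x\<in>A. b (g x) = g (a x))"
  using assms
proof (induction A arbitrary: B rule: finite_psubset_induct)
  case (psubset A)
  note a = psubset.prems(3) and b = psubset.prems(4)
  show ?case
  proof (cases "A = {}")
    case True
    then show ?thesis using psubset.prems by (auto simp: bij_betw_def)
  next
    case False
    then obtain x where x: "x \<in> A" by blast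
    then obtain y where y: "y \<in> B" using psubset.prems(2) psubset.hyps
      by (metis card_0_eq empty_iff psubset.prems(1) all_not_in_conv)
    let ?A = "A - {x, a x}" and ?B = "B - {y, b y}"
    have "\<exists>g. bij_betw g ?A ?B \<and> (\<forall>x\<in>?A. b (g x) = g (a x))"
    proof (rule psubset.IH)
      show "?A \<subset> A" using x by blast
      show "finite ?B" using psubset.prems by simp
      have "card {x, a x} = 2" "card {y, b y} = 2" using a[OF x] b[OF y] by (auto simp: card_2_iff)
      then show "card ?A = card ?B"
        using psubset.prems(1,2) psubset.hyps x y a[OF x] b[OF y] by (simp add: card_Diff_subset)
      show "a z \<in> ?A \<and> a z \<noteq> z \<and> a (a z) = z" if "z \<in> ?A" for z
        using that a x by (metis Diff_iff insert_iff empty_iff)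
      show "b z \<in> ?B \<and> b z \<noteq> z \<and> b (b z) = z" if "z \<in> ?B" for z
        using that b y by (metis Diff_iff insert_iff empty_iff)
    qed
    then obtain g where g: "bij_betw g ?A ?B" "\<forall>x\<in>?A. b (g x) = g (a x)" by blast
    let ?g = "g(x := y, a x := b y)"
    have "bij_betw ?g ?A ?B" using g(1) by (subst bij_betw_cong[of _ _ g]) auto
    moreover have "bij_betw ?g {x, a x} {y, b y}"
      using a[OF x] b[OF y] by (auto simp: bij_betw_def)
    ultimately have "bij_betw ?g (?A \<union> {x, a x}) (?B \<union> {y, b y})"
      by (rule bij_betw_combine) auto
    moreover have "?A \<union> {x, a x} = A" "?B \<union> {y, b y} = B" using a[OF x] b[OF y] x y by auto
    ultimately have "bij_betw ?g A B" by (simp only:)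
    moreover have "b (?g z) = ?g (a z)" if "z \<in> A" for z
    proof -
      have "a z \<noteq> x \<and> a z \<noteq> a x" if "z \<noteq> x" "z \<noteq> a x" using that a \<open>z \<in> A\<close> x by metis
      then show ?thesis using g(2) that a[OF x] b[OF y] by auto
    qed
    ultimately show ?thesis by blast
  qed
qed

text \<open>The preimage under \<open>c\<close> of a closed subset of \<open>B\<close> is a closed
  subset of \<open>A\<close>.\<close>

lemma transitive_on_image:
  assumes "transitive_on f g A" "bij_betw c A B"
    and "\<And>x. x \<in> A \<Longrightarrow> f x \<in> A \<and> f' (c x) = c (f x)"
    and "\<And>x. x \<in> A \<Longrightarrow> g x \<in> A \<and> g' (c x) = c (g x)"
  shows "transitive_on f' g' B"
  unfolding transitive_on_def
proof (intro allI impI)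
  fix U assume U: "U \<subseteq> B" "U \<noteq> {}" "f' ` U \<subseteq> U" "g' ` U \<subseteq> U"
  let ?V = "{x \<in> A. c x \<in> U}"
  have B: "B = c ` A" using assms(2) by (simp add: bij_betw_def)
  have "f ` ?V \<subseteq> ?V" "g ` ?V \<subseteq> ?V"
    using assms(3,4) U(3,4) by auto
  moreover obtain x where "x \<in> ?V" using U(1,2) B by auto
  moreover have "?V \<subseteq> A" by auto
  ultimately have "?V = A" by (intro transitive_onD[OF assms(1)])
  then show "U = B" using U(1) B by auto
qed

section \<open>From transitive permutations to rooted maps\<close>

definition transitive_perms :: "nat \<Rightarrow> (nat \<Rightarrow> nat) set" where
  "transitive_perms n = {\<sigma>. \<sigma> permutes {..<2 * n} \<and> transitive_on \<sigma> (mate n) {..<2 * n}}"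

text \<open>The smallest half-edge at a vertex serves as its name.\<close>

definition perm_map :: "nat \<Rightarrow> (nat \<Rightarrow> nat) \<Rightarrow> nat \<Rightarrow> nat_map" where
  "perm_map n \<sigma> h =
     \<lparr>graph = \<lparr>verts = (\<lambda>k. Min (orbit \<sigma> k)) ` {..<2 * n}, arcs = {..<2 * n},
        tail = \<lambda>k. Min (orbit \<sigma> k), head = \<lambda>k. Min (orbit \<sigma> (mate n k))\<rparr>,
      opp = mate n, nxt = \<sigma>, root = Between h (\<sigma> h)\<rparr>"

lemma perm_map_simps [simp]:
  "half_edges (perm_map n \<sigma> h) = {..<2 * n}"
  "opp (perm_map n \<sigma> h) = mate n"
  "nxt (perm_map n \<sigma> h) = \<sigma>"
  "root (perm_map n \<sigma> h) = Between h (\<sigma> h)"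
  by (simp_all add: perm_map_def)

text \<open>The minimum belongs to its orbit, and two orbits of a permutation that share an element
  coincide. Minima are therefore faithful names of vertices.\<close>

lemma Min_orbit_eq_iff:
  fixes \<sigma> :: "'a :: linorder \<Rightarrow> 'a"
  assumes "\<sigma> permutes A" "finite A"
  shows "Min (orbit \<sigma> x) = Min (orbit \<sigma> y) \<longleftrightarrow> y \<in> orbit \<sigma> x"
proof -
  have \<sigma>: "permutation \<sigma>" using assms by (auto simp: permutation_permutes)
  have Min: "Min (orbit \<sigma> z) \<in> orbit \<sigma> z" for z
    by (intro Min_in finite_orbit permutation_self_in_orbit \<sigma> orbit_nonempty)
  have eq: "orbit \<sigma> z = orbit \<sigma> w" if "z \<in> orbit \<sigma> w" for z w
    using cyclic_on_orbit'[OF \<sigma>] that by (rule orbit_cyclic_eq3)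
  show ?thesis
    using Min[of x] Min[of y] eq permutation_self_in_orbit[OF \<sigma>] by metis
qed

text \<open>For connectedness, consider the labels whose vertex is reachable from that of
  \<open>x\<close>. This set is closed under \<open>\<sigma>\<close>, which stays at the vertex, and
  under \<open>mate n\<close>, which crosses an edge; transitivity makes it everything.\<close>

lemma is_map_perm_map:
  assumes "\<sigma> \<in> transitive_perms n" "0 < n"
  shows "is_map (perm_map n \<sigma> h)"
proof -
  let ?M = "perm_map n \<sigma> h" and ?t = "\<lambda>k. Min (orbit \<sigma> k)"
  have \<sigma>: "\<sigma> permutes {..<2 * n}" and trans: "transitive_on \<sigma> (mate n) {..<2 * n}"
    using assms by (auto simp: transitive_perms_def)
  have perm: "permutation \<sigma>" using \<sigma> by (auto simp: permutation_permutes)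
  have G: "vertices ?M = ?t ` {..<2 * n}" "tail (graph ?M) = ?t" "head (graph ?M) = (\<lambda>k. ?t (mate n k))"
    by (simp_all add: perm_map_def)
  interpret fin_digraph "graph ?M"
    by unfold_locales (auto simp: G)
  interpret bidirected_digraph "graph ?M" "mate n"
    by (rule bidirected_digraphI) (auto simp: G)
  have at: "half_edges_at ?M (?t x) = orbit \<sigma> x" if "x < 2 * n" for x
  proof -
    have "half_edges_at ?M (?t x) = {y. y < 2 * n \<and> ?t x = ?t y}"
      by (auto simp: out_arcs_def perm_map_def)
    then show ?thesis
      using permutes_orbit_subset[OF \<sigma>, of x] that
      by (auto simp: Min_orbit_eq_iff[OF \<sigma> finite_lessThan])
  qed
  have reach: "?t x \<rightarrow>\<^sup>*\<^bsub>graph ?M\<^esub> ?t y" if "x < 2 * n" "y < 2 * n" for x y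
  proof -
    let ?U = "{y. y < 2 * n \<and> ?t x \<rightarrow>\<^sup>*\<^bsub>graph ?M\<^esub> ?t y}"
    have "x \<in> ?U" using that by (auto simp: G)
    moreover have "\<sigma> ` ?U \<subseteq> ?U"
    proof (rule image_subsetI)
      fix y assume "y \<in> ?U"
      then show "\<sigma> y \<in> ?U"
        using permutes_in_image[OF \<sigma>, of y] by (simp add: permutation_orbit_step[OF perm])
    qed
    moreover have "mate n ` ?U \<subseteq> ?U"
    proof (rule image_subsetI)
      fix y assume "y \<in> ?U"
      then have y: "?t x \<rightarrow>\<^sup>*\<^bsub>graph ?M\<^esub> ?t y" "y < 2 * n" by blast+
      have "?t y \<rightarrow>\<^bsub>graph ?M\<^esub> ?t (mate n y)"
        unfolding arcs_ends_conv G perm_map_simps using y(2) by blast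
      with y(1) have "?t x \<rightarrow>\<^sup>*\<^bsub>graph ?M\<^esub> ?t (mate n y)" by (rule reachable_adj_trans)
      then show "mate n y \<in> ?U" using y(2) by simp
    qed
    moreover have "?U \<subseteq> {..<2 * n}" by auto
    ultimately have "?U = {..<2 * n}" by (intro transitive_onD[OF trans])
    then show ?thesis using that by blast
  qed
  \<comment> \<open>Strong connectedness includes a nonempty vertex set, which \<open>0 < n\<close>
    provides.\<close>
  have "Digraph_Component.connected (graph ?M)"
    unfolding connected_iff strongly_connected_def using assms(2) reach by (auto simp: G lessThan_empty_iff)
  moreover have "cyclic_on \<sigma> (half_edges_at ?M v)" if "v \<in> vertices ?M" for v
    using that at cyclic_on_orbit'[OF perm] by (auto simp: G(1))
  ultimately show ?thesis
    unfolding is_map_def using fin_digraph_axioms bidirected_digraph_axioms by simp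
qed

lemma perm_map_in_map_representatives:
  assumes "\<sigma> \<in> transitive_perms n" "h < 2 * n"
  shows "perm_map n \<sigma> h \<in> map_representatives n"
proof -
  have "is_map (perm_map n \<sigma> h)" using assms by (intro is_map_perm_map) auto
  then show ?thesis
    using card_half_edges[of "perm_map n \<sigma> h"] assms(2)
    by (auto simp: map_representatives_def is_rooted_map_def corners_def)
qed

section \<open>From rooted maps to transitive permutations\<close>

text \<open>Each half-edge lies in its own orbit and so is a value of \<open>nxt\<close> on that
  orbit; surjectivity gives injectivity by finiteness.\<close>

lemma bij_betw_nxt:
  assumes "is_map M"
  shows "bij_betw (nxt M) (half_edges M) (half_edges M)"
proof -
  interpret fin_digraph "graph M" using assms by (simp add: is_map_def)
  have "nxt M ` half_edges M = half_edges M"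
  proof (intro equalityI subsetI)
    fix h assume h: "h \<in> half_edges M"
    then have "h \<in> orbit (nxt M) h" using orbit_nxt[OF assms h] by simp
    then show "h \<in> nxt M ` half_edges M"
    proof cases
      case (step k)
      then show ?thesis using orbit_nxt[OF assms h] by auto
    qed (use h in auto)
  qed (use nxt_in_half_edges[OF assms] in auto)
  then show ?thesis by (auto simp: bij_betw_def intro: eq_card_imp_inj_on)
qed

text \<open>Label the half-edges by a bijection \<open>g\<close> that turns \<open>opp\<close> into
  \<open>mate n\<close>, and transport \<open>nxt\<close> along it. Transitivity is transported too,
  and \<open>g\<close> induces the isomorphism.\<close>

lemma obtain_perm_map:
  assumes "M \<in> map_representatives n" "0 < n"
  obtains \<sigma> h where "\<sigma> \<in> transitive_perms n" "h < 2 * n" "rooted_iso M (perm_map n \<sigma> h)"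
proof -
  have M: "is_map M" "is_rooted_map M" "card (edges M) = n"
    using assms by (auto simp: map_representatives_def is_rooted_map_def)
  interpret fin_digraph "graph M" using M by (simp add: is_map_def)
  interpret bidirected_digraph "graph M" "opp M" using M by (simp add: is_map_def)
  let ?H = "half_edges M"
  have card: "card ?H = 2 * n" using card_half_edges M by metis
  have "\<exists>g. bij_betw g ?H {..<2 * n} \<and> (\<forall>x\<in>?H. mate n (g x) = g (opp M x))"
    by (rule fixpoint_free_involution_iso) (auto simp: card arev_dom[symmetric])
  then obtain g where g: "bij_betw g ?H {..<2 * n}" "\<And>x. x \<in> ?H \<Longrightarrow> mate n (g x) = g (opp M x)"
    by blast
  define \<sigma> where "\<sigma> x = (if x < 2 * n then g (nxt M (inv_into ?H g x)) else x)" for x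
  have gH: "g x < 2 * n" if "x \<in> ?H" for x using g(1) that by (auto simp: bij_betw_def)
  have nxt: "\<sigma> (g x) = g (nxt M x)" if "x \<in> ?H" for x
    using bij_betw_inv_into_left[OF g(1) that] gH[OF that] by (simp add: \<sigma>_def)
  have "bij_betw (g \<circ> (nxt M \<circ> inv_into ?H g)) {..<2 * n} {..<2 * n}"
    by (intro bij_betw_trans[OF bij_betw_trans[OF bij_betw_inv_into[OF g(1)] bij_betw_nxt[OF M(1)]] g(1)])
  then have "bij_betw \<sigma> {..<2 * n} {..<2 * n}"
    by (subst bij_betw_cong[of _ _ "g \<circ> (nxt M \<circ> inv_into ?H g)"]) (auto simp: \<sigma>_def)
  then have "\<sigma> permutes {..<2 * n}" by (rule bij_imp_permutes) (simp add: \<sigma>_def)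
  moreover have "transitive_on \<sigma> (mate n) {..<2 * n}"
    by (rule transitive_on_image[OF is_map_transitive_on[OF M(1)] g(1)])
      (auto simp: nxt g(2) nxt_in_half_edges[OF M(1)])
  ultimately have \<sigma>: "\<sigma> \<in> transitive_perms n" by (simp add: transitive_perms_def)
  have "?H \<noteq> {}" using card assms(2) by auto
  then obtain h where h: "h \<in> ?H" "root M = Between h (nxt M h)" using root_cases M(2) by metis
  have "rooted_iso M (perm_map n \<sigma> (g h))"
    using M(1) is_map_perm_map[OF \<sigma> assms(2)] h(1)
    by (rule rooted_isoI[where g = g]) (simp_all add: g nxt h)
  then show ?thesis using that \<sigma> gH h(1) by blast
qed

lemma num_leaves_perm_map:
  assumes "C \<in> rooted_maps n" "perm_map n \<sigma> h \<in> C" "\<sigma> \<in> transitive_perms n" "0 < n"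
  shows "num_leaves C = card {x \<in> {..<2 * n}. \<sigma> x = x}"
  using trans[OF num_leaves_eq[OF assms(1,2)] card_leaves[OF is_map_perm_map[OF assms(3,4)]]]
  unfolding perm_map_simps .

lemma rooted_mapsE:
  assumes "C \<in> rooted_maps n"
  obtains M where "M \<in> map_representatives n"
    "C = {N \<in> map_representatives n. rooted_iso M N}"
proof -
  let ?r = "{(M, N). M \<in> map_representatives n \<and> N \<in> map_representatives n \<and> rooted_iso M N}"
  obtain M where M: "M \<in> map_representatives n" "C = ?r `` {M}"
    using assms unfolding rooted_maps_def by (rule quotientE)
  have "?r `` {M} = {N \<in> map_representatives n. rooted_iso M N}" using M(1) by blast
  with M show ?thesis by (intro that) simp_all
qed

section \<open>Counting rooted maps by leaves\<close>

text \<open>The relabellings that send standard edges to standard edges, forming a hyperoctahedral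
  group. Its order is the number of labelled versions of each rooted map and cancels in the
  probabilities.\<close>

definition mate_centralizer :: "nat \<Rightarrow> (nat \<Rightarrow> nat) set" where
  "mate_centralizer n = {c. c permutes {..<2 * n} \<and> (\<forall>x. c (mate n x) = mate n (c x))}"

text \<open>The centralizer of \<open>mate n\<close> acts on rooted transitive permutations, with the isomorphism
  classes as orbits; transitivity makes the action free.\<close>

lemma card_fibre:
  assumes "C \<in> rooted_maps n" "0 < n"
  shows "card {(\<sigma>, h). \<sigma> \<in> transitive_perms n \<and> h < 2 * n \<and> perm_map n \<sigma> h \<in> C} =
    card (mate_centralizer n)"
proof -
  let ?F = "{(\<sigma>, h). \<sigma> \<in> transitive_perms n \<and> h < 2 * n \<and> perm_map n \<sigma> h \<in> C}"
  obtain M where M: "M \<in> map_representatives n" "C = {N \<in> map_representatives n. rooted_iso M N}"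
    using assms(1) by (rule rooted_mapsE)
  obtain \<sigma> h where \<sigma>: "\<sigma> \<in> transitive_perms n" and h: "h < 2 * n"
    and iso: "rooted_iso M (perm_map n \<sigma> h)"
    using obtain_perm_map[OF M(1) assms(2)] .
  have \<sigma>': "\<sigma> permutes {..<2 * n}" "transitive_on \<sigma> (mate n) {..<2 * n}"
    using \<sigma> by (auto simp: transitive_perms_def)
  \<comment> \<open>Relabelling by \<open>c\<close> conjugates the permutation and moves the root
    label.\<close>
  let ?act = "\<lambda>c. (c \<circ> \<sigma> \<circ> inv c, c h)"
  have conj: "(c \<circ> \<sigma> \<circ> inv c) (c x) = c (\<sigma> x)" if "c \<in> mate_centralizer n" for c x
    using that permutes_inverses(2)[of c "{..<2 * n}" x] by (simp add: mate_centralizer_def)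
  have "bij_betw ?act (mate_centralizer n) ?F"
  proof (rule bij_betw_imageI)
    show "inj_on ?act (mate_centralizer n)"
    proof (rule inj_onI)
      fix c d assume cd: "c \<in> mate_centralizer n" "d \<in> mate_centralizer n" "?act c = ?act d"
      \<comment> \<open>The set where \<open>c\<close> and \<open>d\<close> agree contains the root
        label \<open>h\<close> and is closed under \<open>\<sigma>\<close> and
        \<open>mate n\<close>, so transitivity forces \<open>c = d\<close>.\<close>
      let ?U = "{x \<in> {..<2 * n}. c x = d x}"
      have "c (\<sigma> x) = d (\<sigma> x)" if "c x = d x" for x
        using conj[OF cd(1), of x] conj[OF cd(2), of x] cd(3) that by (metis prod.inject)
      then have "\<sigma> ` ?U \<subseteq> ?U" using permutes_in_image[OF \<sigma>'(1)] by auto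
      moreover have "mate n ` ?U \<subseteq> ?U" using cd(1,2) by (auto simp: mate_centralizer_def)
      moreover have "h \<in> ?U" using h cd(3) by simp
      moreover have "?U \<subseteq> {..<2 * n}" by auto
      ultimately have "?U = {..<2 * n}" by (intro transitive_onD[OF \<sigma>'(2)])
      then have "c x = d x" if "x < 2 * n" for x using that by blast
      moreover have "c x = d x" if "\<not> x < 2 * n" for x
        using cd(1,2) that permutes_not_in[of c "{..<2 * n}" x] permutes_not_in[of d "{..<2 * n}" x]
        by (simp add: mate_centralizer_def)
      ultimately show "c = d" by (intro ext) metis
    qed
    show "?act ` mate_centralizer n = ?F"
    proof (intro equalityI subsetI)
      fix p assume "p \<in> ?act ` mate_centralizer n"
      then obtain c where c: "c \<in> mate_centralizer n" "p = ?act c" by blast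
      let ?\<tau> = "c \<circ> \<sigma> \<circ> inv c"
      have perm: "c permutes {..<2 * n}" using c(1) by (simp add: mate_centralizer_def)
      have bij: "bij_betw c {..<2 * n} {..<2 * n}" using perm by (rule permutes_imp_bij)
      have "?\<tau> permutes {..<2 * n}"
        using perm \<sigma>'(1) by (intro permutes_compose permutes_inv)
      moreover have "transitive_on ?\<tau> (mate n) {..<2 * n}"
        using \<sigma>'(2) bij
      proof (rule transitive_on_image)
        show "\<sigma> x \<in> {..<2 * n} \<and> ?\<tau> (c x) = c (\<sigma> x)" if "x \<in> {..<2 * n}" for x
          using that permutes_in_image[OF \<sigma>'(1)] conj[OF c(1)] by metis
        show "mate n x \<in> {..<2 * n} \<and> mate n (c x) = c (mate n x)" if "x \<in> {..<2 * n}" for x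
          using that c(1) by (simp add: mate_centralizer_def)
      qed
      ultimately have \<tau>: "?\<tau> \<in> transitive_perms n" by (simp add: transitive_perms_def)
      have ch: "c h < 2 * n" using permutes_in_image[OF perm, of h] h by simp
      have "rooted_iso (perm_map n \<sigma> h) (perm_map n ?\<tau> (c h))"
        using is_map_perm_map[OF \<sigma> assms(2)] is_map_perm_map[OF \<tau> assms(2)]
      proof (rule rooted_isoI[where g = c and h = h])
        show "nxt (perm_map n ?\<tau> (c h)) (c k) = c (nxt (perm_map n \<sigma> h) k)" for k
          unfolding perm_map_simps by (rule conj[OF c(1)])
      qed (use h bij c(1) in \<open>simp_all add: mate_centralizer_def\<close>)
      then have "rooted_iso M (perm_map n ?\<tau> (c h))" using iso by (rule rooted_iso_trans[rotated])
      then show "p \<in> ?F"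
        using c(2) \<tau> ch perm_map_in_map_representatives[OF \<tau> ch] M(2) by simp
    next
      fix p assume "p \<in> ?F"
      then obtain \<tau> k where p: "p = (\<tau>, k)" "\<tau> \<in> transitive_perms n" "k < 2 * n"
        "rooted_iso M (perm_map n \<tau> k)"
        using M(2) by auto
      have "rooted_iso (perm_map n \<sigma> h) (perm_map n \<tau> k)"
        using M(1) rooted_iso_trans[OF rooted_iso_sym[OF _ iso] p(4)]
        by (simp add: map_representatives_def)
      \<comment> \<open>The half-edge part of the isomorphism suffices: it intertwines both pairs of
        permutations, and preservation of the root corner yields \<open>k = g h\<close>.\<close>
      then obtain g where g: "bij_betw g {..<2 * n} {..<2 * n}"
        "\<And>x. x < 2 * n \<Longrightarrow> mate n (g x) = g (mate n x) \<and> \<tau> (g x) = g (\<sigma> x)" "k = g h"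
        by (auto simp: rooted_iso_def)
      \<comment> \<open>The isomorphism says nothing about \<open>g\<close> off the labels; setting
        it to the identity there gives a permutation of \<open>{..<2 * n}\<close>.\<close>
      define c where "c x = (if x < 2 * n then g x else x)" for x
      have "bij_betw c {..<2 * n} {..<2 * n}"
        using g(1) by (subst bij_betw_cong[of _ _ g]) (auto simp: c_def)
      then have perm: "c permutes {..<2 * n}" by (rule bij_imp_permutes) (simp add: c_def)
      have c: "c \<in> mate_centralizer n"
        using perm g(2) by (simp add: mate_centralizer_def c_def)
      have "\<tau> (c x) = c (\<sigma> x)" for x
      proof (cases "x < 2 * n")
        case True
        then show ?thesis using g(2) permutes_in_image[OF \<sigma>'(1), of x] by (simp add: c_def)
      next
        case False
        then show ?thesis
          using p(2) permutes_not_in[OF \<sigma>'(1), of x] permutes_not_in[of \<tau> "{..<2 * n}" x]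
          by (simp add: c_def transitive_perms_def)
      qed
      then have "\<tau> = c \<circ> \<sigma> \<circ> inv c"
        using permutes_inverses(1)[OF perm] by (auto simp: fun_eq_iff) metis
      then show "p \<in> ?act ` mate_centralizer n" using c p(1) g(3) h by (auto simp: c_def)
    qed
  qed
  then show ?thesis by (simp add: bij_betw_same_card)
qed

lemma finite_transitive_perms: "finite (transitive_perms n)"
  by (rule finite_subset[OF _ finite_permutations[OF finite_lessThan[of "2 * n"]]])
    (auto simp: transitive_perms_def)

lemma perm_map_class:
  assumes "\<sigma> \<in> transitive_perms n" "h < 2 * n"
  shows "\<exists>!C. C \<in> rooted_maps n \<and> perm_map n \<sigma> h \<in> C"
proof -
  have "perm_map n \<sigma> h \<in> \<Union>(rooted_maps n)"
    using perm_map_in_map_representatives[OF assms]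
    unfolding rooted_maps_def by (simp only: Union_quotient[OF equiv_rooted_iso])
  then obtain C where C: "C \<in> rooted_maps n" "perm_map n \<sigma> h \<in> C" by blast
  have "D = C" if D: "D \<in> rooted_maps n" "perm_map n \<sigma> h \<in> D" for D
    using quotient_disj[OF equiv_rooted_iso D(1)[unfolded rooted_maps_def] C(1)[unfolded rooted_maps_def]]
      C(2) D(2) by blast
  with C show ?thesis by blast
qed

text \<open>Every class contains some \<open>perm_map n \<sigma> h\<close>, so the classes are an
  image of the finite set of pairs of a transitive permutation and a root label.\<close>

lemma finite_rooted_maps:
  assumes "0 < n"
  shows "finite (rooted_maps n)"
proof -
  let ?c = "\<lambda>(\<sigma>, h). THE C. C \<in> rooted_maps n \<and> perm_map n \<sigma> h \<in> C"
  have "rooted_maps n \<subseteq> ?c ` (transitive_perms n \<times> {..<2 * n})"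
  proof
    fix C assume C: "C \<in> rooted_maps n"
    obtain M where M: "M \<in> map_representatives n" "C = {N \<in> map_representatives n. rooted_iso M N}"
      using C by (rule rooted_mapsE)
    obtain \<sigma> h where \<sigma>: "\<sigma> \<in> transitive_perms n" "h < 2 * n" "rooted_iso M (perm_map n \<sigma> h)"
      using obtain_perm_map[OF M(1) assms] .
    then have "perm_map n \<sigma> h \<in> C" using M(2) perm_map_in_map_representatives by blast
    then have "?c (\<sigma>, h) = C" using the1_equality[OF perm_map_class[OF \<sigma>(1,2)]] C by simp
    then show "C \<in> ?c ` (transitive_perms n \<times> {..<2 * n})" using \<sigma> by blast
  qed
  then show ?thesis by (rule finite_subset) (simp add: finite_transitive_perms)
qed

text \<open>The pairs of a transitive permutation and a root label are counted in two ways: grouped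
  by class, each fibre has the size of the centralizer; grouped by permutation, there are
  \<open>2 * n\<close> roots. Taking \<open>S\<close> to be a singleton or \<open>UNIV\<close> gives
  numerator and denominator of a probability.\<close>

lemma card_rooted_maps_leaves:
  assumes "0 < n"
  shows "card (mate_centralizer n) * card {C \<in> rooted_maps n. num_leaves C \<in> S} =
    2 * n * card {\<sigma> \<in> transitive_perms n. card {x \<in> {..<2 * n}. \<sigma> x = x} \<in> S}"
proof -
  let ?R = "{C \<in> rooted_maps n. num_leaves C \<in> S}"
  let ?T = "{\<sigma> \<in> transitive_perms n. card {x \<in> {..<2 * n}. \<sigma> x = x} \<in> S}"
  let ?F = "\<lambda>C. {(\<sigma>, h). \<sigma> \<in> transitive_perms n \<and> h < 2 * n \<and> perm_map n \<sigma> h \<in> C}"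
  have fin: "finite (?F C)" for C
    by (rule finite_subset[of _ "transitive_perms n \<times> {..<2 * n}"])
      (auto intro: finite_transitive_perms)
  have leaves: "num_leaves C = card {x \<in> {..<2 * n}. \<sigma> x = x}"
    if "C \<in> rooted_maps n" "(\<sigma>, h) \<in> ?F C" for C \<sigma> h
    using that by (intro num_leaves_perm_map[OF _ _ _ assms]) auto
  have "?T \<times> {..<2 * n} = (\<Union>C\<in>?R. ?F C)"
  proof (intro equalityI subsetI)
    fix p assume "p \<in> ?T \<times> {..<2 * n}"
    then obtain \<sigma> h where p: "p = (\<sigma>, h)" "\<sigma> \<in> ?T" "h < 2 * n" by blast
    then obtain C where C: "C \<in> rooted_maps n" "perm_map n \<sigma> h \<in> C"
      using perm_map_class[of \<sigma> n h] by blast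
    then have "p \<in> ?F C" using p by simp
    then have "num_leaves C = card {x \<in> {..<2 * n}. \<sigma> x = x}"
      using leaves[OF C(1)] p(1) by blast
    then have "C \<in> ?R" using C(1) p(2) by simp
    with \<open>p \<in> ?F C\<close> show "p \<in> (\<Union>C\<in>?R. ?F C)" by blast
  next
    fix p assume "p \<in> (\<Union>C\<in>?R. ?F C)"
    then obtain C \<sigma> h where C: "C \<in> ?R" "p = (\<sigma>, h)" "(\<sigma>, h) \<in> ?F C" by fast
    then show "p \<in> ?T \<times> {..<2 * n}" using leaves[of C \<sigma> h] by simp
  qed
  then have "card (?T \<times> {..<2 * n}) = card (\<Union>C\<in>?R. ?F C)" by simp
  also have "\<dots> = (\<Sum>C\<in>?R. card (?F C))"
  proof (rule card_UN_disjoint)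
    show "\<forall>C\<in>?R. \<forall>D\<in>?R. C \<noteq> D \<longrightarrow> ?F C \<inter> ?F D = {}"
      using perm_map_class by blast
  qed (use finite_rooted_maps[OF assms] fin in auto)
  also have "\<dots> = (\<Sum>C\<in>?R. card (mate_centralizer n))"
    using card_fibre[OF _ assms] by (intro sum.cong) auto
  finally show ?thesis by (simp add: card_cartesian_product mult.commute)
qed

section \<open>The limit law\<close>

text \<open>On the naturals the distribution function at \<open>x\<close> is a finite sum of point
  masses, so it converges at every \<open>x\<close>, jumps included.\<close>

lemma weak_conv_m_natI:
  fixes P :: "nat \<Rightarrow> nat pmf"
  assumes "\<And>k. (\<lambda>n. pmf (P n) k) \<longlonglongrightarrow> pmf Q k"
  shows "weak_conv_m (\<lambda>n. distr (measure_pmf (P n)) borel real) (distr (measure_pmf Q) borel real)"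
proof -
  have fin: "finite {k. real k \<le> x}" for x
    by (rule finite_subset[of _ "{..nat \<lfloor>x\<rfloor>}"]) (auto simp: le_nat_floor)
  have cdf: "cdf (distr (measure_pmf p) borel real) x = (\<Sum>k | real k \<le> x. pmf p k)" for p x
    using fin by (simp add: cdf_def measure_distr vimage_def measure_measure_pmf_finite)
  show ?thesis
    unfolding weak_conv_m_def weak_conv_def cdf by (intro allI impI tendsto_sum assms)
qed

lemma transitive_perms_limit:
  "(\<lambda>n. real (card (transitive_perms n)) / fact (2 * n)) \<longlonglongrightarrow> 1"
  "(\<lambda>n. real (card {\<sigma> \<in> transitive_perms n. card {x \<in> {..<2 * n}. \<sigma> x = x} = k}) / fact (2 * n))
     \<longlonglongrightarrow> exp (-1) / fact k"
proof -
  let ?P = "\<lambda>n. {\<sigma>. \<sigma> permutes {..<2 * n}}"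
  let ?N = "\<lambda>n. {\<sigma> \<in> ?P n. \<not> transitive_on \<sigma> (mate n) {..<2 * n}}"
  have fin: "finite {\<sigma> \<in> ?P n. R \<sigma>}" for n :: nat and R
    by (rule finite_subset[OF _ finite_permutations[OF finite_lessThan[of "2 * n"]]]) auto
  have N: "(\<lambda>n. real (card (?N n)) / fact (2 * n)) \<longlonglongrightarrow> 0"
    using sum_inverse_choose_tendsto_0
    by (rule tendsto_sandwich[rotated 2, OF tendsto_const])
      (use card_not_transitive in auto)
  \<comment> \<open>Restricting to transitive permutations discards at most the vanishing proportion
    \<open>?N n\<close>, so every property keeps its limiting proportion. \<open>R\<close> may
    depend on \<open>n\<close> because the fixed points are counted in
    \<open>{..<2 * n}\<close>.\<close>
  have lim: "(\<lambda>n. real (card {\<sigma> \<in> transitive_perms n. R n \<sigma>}) / fact (2 * n)) \<longlonglongrightarrow> l"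
    if R: "(\<lambda>n. real (card {\<sigma> \<in> ?P n. R n \<sigma>}) / fact (2 * n)) \<longlonglongrightarrow> l"
    for R :: "nat \<Rightarrow> (nat \<Rightarrow> nat) \<Rightarrow> bool" and l
  proof (rule tendsto_sandwich)
    have "card {\<sigma> \<in> ?P n. R n \<sigma>} \<le> card {\<sigma> \<in> transitive_perms n. R n \<sigma>} + card (?N n)" for n
    proof -
      have "card {\<sigma> \<in> ?P n. R n \<sigma>} \<le> card ({\<sigma> \<in> transitive_perms n. R n \<sigma>} \<union> ?N n)"
        using fin finite_transitive_perms by (intro card_mono) (auto simp: transitive_perms_def)
      then show ?thesis using card_Un_le le_trans by blast
    qed
    then have "real (card {\<sigma> \<in> ?P n. R n \<sigma>}) / fact (2 * n) \<le>
        (real (card {\<sigma> \<in> transitive_perms n. R n \<sigma>}) + real (card (?N n))) / fact (2 * n)" for n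
      by (intro divide_right_mono) (simp_all flip: of_nat_add)
    then show "\<forall>\<^sub>F n in sequentially.
        real (card {\<sigma> \<in> ?P n. R n \<sigma>}) / fact (2 * n) - real (card (?N n)) / fact (2 * n) \<le>
        real (card {\<sigma> \<in> transitive_perms n. R n \<sigma>}) / fact (2 * n)"
      by (simp add: add_divide_distrib diff_le_eq)
    show "\<forall>\<^sub>F n in sequentially. real (card {\<sigma> \<in> transitive_perms n. R n \<sigma>}) / fact (2 * n) \<le>
        real (card {\<sigma> \<in> ?P n. R n \<sigma>}) / fact (2 * n)"
      using fin by (intro always_eventually allI divide_right_mono)
        (auto simp: transitive_perms_def intro: card_mono)
    show "(\<lambda>n. real (card {\<sigma> \<in> ?P n. R n \<sigma>}) / fact (2 * n) - real (card (?N n)) / fact (2 * n)) \<longlonglongrightarrow> l"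
      using tendsto_diff[OF R N] by simp
  qed (fact R)
  show "(\<lambda>n. real (card (transitive_perms n)) / fact (2 * n)) \<longlonglongrightarrow> 1"
    using lim[of "\<lambda>_ _. True" 1] by (simp add: card_permutations)
  \<comment> \<open>The fixed-point limit is taken along the even sizes, \<open>2 * n\<close> being
    the number of half-edges.\<close>
  have "filterlim (\<lambda>n. 2 * n :: nat) sequentially sequentially"
    by (rule filterlim_subseq) (simp add: strict_mono_def)
  from filterlim_compose[OF fixed_points_limit[of k] this]
  have "(\<lambda>n. real (card {\<sigma> \<in> ?P n. card {x \<in> {..<2 * n}. \<sigma> x = x} = k}) / fact (2 * n))
      \<longlonglongrightarrow> exp (-1) / fact k"
    by simp
  then show "(\<lambda>n. real (card {\<sigma> \<in> transitive_perms n. card {x \<in> {..<2 * n}. \<sigma> x = x} = k}) / fact (2 * n))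
      \<longlonglongrightarrow> exp (-1) / fact k"
    by (rule lim)
qed

lemma pmf_num_leaves:
  assumes "0 < n" "transitive_perms n \<noteq> {}"
  shows "pmf (map_pmf num_leaves (random_rooted_map n)) k =
    real (card {\<sigma> \<in> transitive_perms n. card {x \<in> {..<2 * n}. \<sigma> x = x} = k}) /
    real (card (transitive_perms n))"
proof -
  let ?Z = "card (mate_centralizer n)"
  note fin = finite_rooted_maps[OF assms(1)]
  note k = card_rooted_maps_leaves[OF assms(1), of "{k}"]
  note all = card_rooted_maps_leaves[OF assms(1), of UNIV]
  \<comment> \<open>Positivity gives a nonempty set of rooted maps, on which
    \<open>pmf_of_set\<close> is uniform, and allows the fraction below to be expanded by
    \<open>?Z\<close>.\<close>
  have pos: "?Z * card (rooted_maps n) > 0"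
    using all assms finite_transitive_perms by (auto simp: card_gt_0_iff)
  then have ne: "rooted_maps n \<noteq> {}" by auto
  have "pmf (map_pmf num_leaves (random_rooted_map n)) k =
      measure (measure_pmf (pmf_of_set (rooted_maps n))) (num_leaves -` {k})"
    by (simp add: pmf_map random_rooted_map_def)
  also have "\<dots> = real (card {C \<in> rooted_maps n. num_leaves C = k}) / real (card (rooted_maps n))"
    using fin ne by (simp add: measure_pmf_of_set vimage_def Int_def)
  also have "\<dots> = real (?Z * card {C \<in> rooted_maps n. num_leaves C = k}) /
      real (?Z * card (rooted_maps n))"
    using pos by simp
  also have "\<dots> = real (2 * n * card {\<sigma> \<in> transitive_perms n. card {x \<in> {..<2 * n}. \<sigma> x = x} = k}) /
      real (2 * n * card (transitive_perms n))"
    using k all by simp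
  also have "\<dots> = real (card {\<sigma> \<in> transitive_perms n. card {x \<in> {..<2 * n}. \<sigma> x = x} = k}) /
      real (card (transitive_perms n))"
    using assms(1) by simp
  finally show ?thesis .
qed

theorem theorem10:
  shows "weak_conv_m
           (\<lambda>n. distr (measure_pmf (random_rooted_map n)) borel (\<lambda>C. real (num_leaves C)))
           (distr (measure_pmf (poisson_pmf 1)) borel real)"
proof -
  have "(\<lambda>n. pmf (map_pmf num_leaves (random_rooted_map n)) k) \<longlonglongrightarrow> pmf (poisson_pmf 1) k" for k
  proof -
    let ?a = "\<lambda>n. real (card {\<sigma> \<in> transitive_perms n. card {x \<in> {..<2 * n}. \<sigma> x = x} = k}) / fact (2 * n)"
    let ?b = "\<lambda>n. real (card (transitive_perms n)) / fact (2 * n)"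
    \<comment> \<open>The factorials cancel, so the quotient is the proportion of permutations with
      \<open>k\<close> fixed points among the transitive ones.\<close>
    have "(\<lambda>n. ?a n / ?b n) \<longlonglongrightarrow> exp (-1) / fact k / 1"
      by (intro tendsto_divide transitive_perms_limit) auto
    moreover have "\<forall>\<^sub>F n in sequentially. ?a n / ?b n = pmf (map_pmf num_leaves (random_rooted_map n)) k"
      \<comment> \<open>As the proportion of transitive permutations tends to 1, it is eventually
        positive, so they eventually exist.\<close>
      using order_tendstoD(1)[OF transitive_perms_limit(1), of 0, simplified] eventually_gt_at_top[of 0]
    proof eventually_elim
      case (elim n)
      then have "transitive_perms n \<noteq> {}" by auto
      then show ?case using elim by (simp add: pmf_num_leaves)
    qed
    ultimately have "(\<lambda>n. pmf (map_pmf num_leaves (random_rooted_map n)) k) \<longlonglongrightarrow> exp (-1) / fact k / 1"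
      by (rule Lim_transform_eventually)
    then show ?thesis by simp
  qed
  then have "weak_conv_m (\<lambda>n. distr (measure_pmf (map_pmf num_leaves (random_rooted_map n))) borel real)
      (distr (measure_pmf (poisson_pmf 1)) borel real)"
    by (rule weak_conv_m_natI)
  then show ?thesis by (simp add: map_pmf_rep_eq distr_distr comp_def)
qed

end
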